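(* Let $\mathcal{X}$ be a standard Borel space, $X$ a countable set, $f:\mathcal{C}\times\mathcal{X}\times\mathcal{X}\to[0,\infty]$ a Borel function such that $\rho(d,p)=\inf_{\mathcal{R}\in\mathcal{C}}f(\mathcal{R},d,p)$ is a pseudometric on $\mathcal{X}$ (with values in $[0,\infty]$), and suppose that for every pair of finite sets $E,F\subseteq X$ there are functions $f^{E,F}:\mathcal{C}^{E,F}\times\mathcal{X}\times\mathcal{X}\to[0,\infty]$ satisfying conditions (1)–(5) given in the context (monotonicity, continuity in upward unions, Borelness, symmetry, transitivity). Then for every $d\in\mathcal{X}$ the set $\{p\in\mathcal{X}:\rho(d,p)=0\}$ is Borel.
   Context: $\mathcal{C}$ is the Polish space of all correspondences on $X$, i.e. relations $\mathcal{R}\subseteq X\times X$ such that each $x\in X$ is $\mathcal{R}$-related to some $y\in X$ and each $y\in X$ has some $x\in X$ with $x\mathcal{R}y$; it is a $G_\delta$ subset of the Polish space $\mathcal{P}(X\times X)\cong 2^{X\times X}$. For finite $E,F\subseteq X$ and $\mathcal{R}\subseteq X\times X$ put $\mathcal{R}^{E,F}=\{(x,y):x\mathcal{R}y,x\in E,y\in F\}$ and $\mathcal{C}^{E,F}=\{\mathcal{R}^{E,F}:\mathcal{R}\in\mathcal{C}\}$. The conditions are: (1) Monotonicity: $f^{E,F}(\mathcal{R}^{E,F},d,p)\leq f^{E',F'}((\mathcal{R}')^{E',F'},d,p)$ whenever $E\subseteq E'$, $F\subseteq F'$ are finite and $\mathcal{R}\subseteq\mathcal{R}'$. (2) Continuity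 in upward unions: $f(\mathcal{R},d,p)=\sup_{E,F}f^{E,F}(\mathcal{R}^{E,F},d,p)=\lim_{E,F}f^{E,F}(\mathcal{R}^{E,F},d,p)$, the limit being over pairs of finite sets that increase in inclusion and eventually cover $X$. (3) Borelness: for all finite $E,F\subseteq X$, $\mathcal{R}\in\mathcal{C}^{E,F}$ and $d\in\mathcal{X}$, the map $\mathcal{X}\ni e\mapsto f^{E,F}(\mathcal{R},d,e)$ is Borel. (4) Symmetry: $f^{E,F}(\mathcal{R}^{E,F},d,p)=f^{F,E}((\mathcal{R}^{E,F})^{-1},p,d)$ for all finite $E,F\subseteq X$, $\mathcal{R}\in\mathcal{C}$, $d,p\in\mathcal{X}$. (5) Transitivity: $f^{E,G}((\mathcal{R}')^{F,G}\circ\mathcal{R}^{E,F},d,e)\leq f^{E,F}(\mathcal{R}^{E,F},d,p)+f^{F,G}((\mathcal{R}')^{F,G},p,e)$ for all finite $E,F,G\subseteq X$, $\mathcal{R},\mathcal{R}'\in\mathcal{C}$, $d,p,e\in\mathcal{X}$, where $(\mathcal{R}')^{F,G}\circ\mathcal{R}^{E,F}=\{(x,z):\exists y\ (x,y)\in\mathcal{R}^{E,F},(y,z)\in(\mathcal{R}')^{F,G}\}$. *)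

theory Defs
  imports "HOL-Analysis.Analysis"
begin

definition borel_of :: "'a topology \<Rightarrow> 'a measure"
  where "borel_of T = sigma (topspace T) {U. openin T U}"

definition polish_topology :: "'a topology \<Rightarrow> bool"
  where "polish_topology T \<longleftrightarrow> completely_metrizable_space T \<and> separable_space T"

text \<open>Only the underlying measurable space of \<open>M\<close> matters; its measure is irrelevant.\<close>

definition standard_borel :: "'a measure \<Rightarrow> bool"
  where "standard_borel M \<longleftrightarrow>
    (\<exists>T. polish_topology T \<and> space M = topspace T \<and> sets M = sets (borel_of T))"

definition correspondences :: "'x set \<Rightarrow> ('x \<times> 'x) set set"
  where "correspondences X =
    {R. R \<subseteq> X \<times> X \<and> (\<forall>x\<in>X. \<exists>y\<in>X. (x, y) \<in> R) \<and> (\<forall>y\<in>X. \<exists>x\<in>X. (x, y) \<in> R)}"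

text \<open>The power set of \<open>A\<close> with the product topology of \<open>2\<^sup>A\<close>, transported along
  characteristic functions. These are restricted to \<open>A\<close> because the points of
  \<^const>\<open>product_topology\<close> are extensional functions.\<close>

definition powerset_topology :: "'b set \<Rightarrow> 'b set topology"
  where "powerset_topology A =
    pullback_topology (Pow A) (\<lambda>R. restrict (\<lambda>a. a \<in> R) A)
      (product_topology (\<lambda>_. discrete_topology (UNIV :: bool set)) A)"

definition correspondence_topology :: "'x set \<Rightarrow> ('x \<times> 'x) set topology"
  where "correspondence_topology X =
    subtopology (powerset_topology (X \<times> X)) (correspondences X)"

lemma topspace_powerset_topology: "topspace (powerset_topology A) = Pow A"
  by (auto simp: powerset_topology_def topspace_pullback_topology)

lemma topspace_correspondence_topology:
  "topspace (correspondence_topology X) = correspondences X"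
  by (auto simp: correspondence_topology_def topspace_powerset_topology correspondences_def)

definition rel_window :: "('x \<times> 'x) set \<Rightarrow> 'x set \<Rightarrow> 'x set \<Rightarrow> ('x \<times> 'x) set"
  where "rel_window R E F = {(x, y). (x, y) \<in> R \<and> x \<in> E \<and> y \<in> F}"

definition correspondence_windows :: "'x set \<Rightarrow> 'x set \<Rightarrow> 'x set \<Rightarrow> ('x \<times> 'x) set set"
  where "correspondence_windows X E F = {rel_window R E F | R. R \<in> correspondences X}"

definition corr_dist ::
  "'x set \<Rightarrow> (('x \<times> 'x) set \<Rightarrow> 'a \<Rightarrow> 'a \<Rightarrow> ennreal) \<Rightarrow> 'a \<Rightarrow> 'a \<Rightarrow> ennreal"
  where "corr_dist X f d p = (INF R\<in>correspondences X. f R d p)"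

definition ext_pseudometric_on :: "'a set \<Rightarrow> ('a \<Rightarrow> 'a \<Rightarrow> ennreal) \<Rightarrow> bool"
  where "ext_pseudometric_on S r \<longleftrightarrow>
    (\<forall>d\<in>S. r d d = 0) \<and>
    (\<forall>d\<in>S. \<forall>p\<in>S. r d p = r p d) \<and>
    (\<forall>d\<in>S. \<forall>p\<in>S. \<forall>e\<in>S. r d e \<le> r d p + r p e)"

text \<open>In the conditions below \<open>g E F\<close> is the function written \<open>f\<close> with superscripts \<open>E,F\<close>. As a
  HOL function it is total, but only its values on
  \<open>correspondence_windows X E F \<times> S \<times> S\<close> are constrained.\<close>

definition window_monotone ::
  "'x set \<Rightarrow> 'a set \<Rightarrow> ('x set \<Rightarrow> 'x set \<Rightarrow> ('x \<times> 'x) set \<Rightarrow> 'a \<Rightarrow> 'a \<Rightarrow> ennreal) \<Rightarrow> bool"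
  where "window_monotone X S g \<longleftrightarrow>
    (\<forall>E E' F F' R R' d p.
      finite E' \<and> E \<subseteq> E' \<and> E' \<subseteq> X \<and> finite F' \<and> F \<subseteq> F' \<and> F' \<subseteq> X \<and>
      R \<in> correspondences X \<and> R' \<in> correspondences X \<and> R \<subseteq> R' \<and> d \<in> S \<and> p \<in> S \<longrightarrow>
      g E F (rel_window R E F) d p \<le> g E' F' (rel_window R' E' F') d p)"

definition window_continuous ::
  "'x set \<Rightarrow> 'a set \<Rightarrow> (('x \<times> 'x) set \<Rightarrow> 'a \<Rightarrow> 'a \<Rightarrow> ennreal) \<Rightarrow>
    ('x set \<Rightarrow> 'x set \<Rightarrow> ('x \<times> 'x) set \<Rightarrow> 'a \<Rightarrow> 'a \<Rightarrow> ennreal) \<Rightarrow> bool"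
  where "window_continuous X S f g \<longleftrightarrow>
    (\<forall>R\<in>correspondences X. \<forall>d\<in>S. \<forall>p\<in>S.
      f R d p = (SUP (E, F)\<in>{E. finite E \<and> E \<subseteq> X} \<times> {F. finite F \<and> F \<subseteq> X}.
                  g E F (rel_window R E F) d p) \<and>
      ((\<lambda>(E, F). g E F (rel_window R E F) d p) \<longlongrightarrow> f R d p)
        (finite_subsets_at_top X \<times>\<^sub>F finite_subsets_at_top X))"

definition window_borel ::
  "'x set \<Rightarrow> 'a measure \<Rightarrow> ('x set \<Rightarrow> 'x set \<Rightarrow> ('x \<times> 'x) set \<Rightarrow> 'a \<Rightarrow> 'a \<Rightarrow> ennreal) \<Rightarrow> bool"
  where "window_borel X M g \<longleftrightarrow>
    (\<forall>E F. finite E \<and> E \<subseteq> X \<and> finite F \<and> F \<subseteq> X \<longrightarrow>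
      (\<forall>R\<in>correspondence_windows X E F. \<forall>d\<in>space M.
        (\<lambda>e. g E F R d e) \<in> borel_measurable M))"

definition window_symmetric ::
  "'x set \<Rightarrow> 'a set \<Rightarrow> ('x set \<Rightarrow> 'x set \<Rightarrow> ('x \<times> 'x) set \<Rightarrow> 'a \<Rightarrow> 'a \<Rightarrow> ennreal) \<Rightarrow> bool"
  where "window_symmetric X S g \<longleftrightarrow>
    (\<forall>E F. finite E \<and> E \<subseteq> X \<and> finite F \<and> F \<subseteq> X \<longrightarrow>
      (\<forall>R\<in>correspondences X. \<forall>d\<in>S. \<forall>p\<in>S.
        g E F (rel_window R E F) d p = g F E ((rel_window R E F)\<inverse>) p d))"

text \<open>If \<open>X\<close> is infinite, every subset of \<open>E \<times> G\<close> is a window of a correspondence and the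
  membership premise is vacuous. If \<open>X\<close> is finite, the composition can fall outside the
  domain of \<open>g E G\<close> (e.g. for \<open>E = G = X\<close> and \<open>F = {}\<close>); the inequality is then not imposed.\<close>

definition window_transitive ::
  "'x set \<Rightarrow> 'a set \<Rightarrow> ('x set \<Rightarrow> 'x set \<Rightarrow> ('x \<times> 'x) set \<Rightarrow> 'a \<Rightarrow> 'a \<Rightarrow> ennreal) \<Rightarrow> bool"
  where "window_transitive X S g \<longleftrightarrow>
    (\<forall>E F G. finite E \<and> E \<subseteq> X \<and> finite F \<and> F \<subseteq> X \<and> finite G \<and> G \<subseteq> X \<longrightarrow>
      (\<forall>R\<in>correspondences X. \<forall>R'\<in>correspondences X. \<forall>d\<in>S. \<forall>p\<in>S. \<forall>e\<in>S.
        rel_window R E F O rel_window R' F G \<in> correspondence_windows X E G \<longrightarrow>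
        g E G (rel_window R E F O rel_window R' F G) d e
          \<le> g E F (rel_window R E F) d p + g F G (rel_window R' F G) p e))"

end

theory Submission
  imports Defs
begin

text \<open>
  The proof is a metric Scott analysis. It has to be decided in a Borel way whether \<open>d\<close> and \<open>p\<close>
  are at distance \<open>0\<close>, that is, whether for every \<open>\<epsilon> > 0\<close> some correspondence costs at most \<open>\<epsilon>\<close>.
  The interesting case is that of infinite \<open>X\<close>, where every finite relation on \<open>X\<close> is a window of
  a correspondence. A correspondence is built by back and forth from finite relations, so one studies
  lower estimates \<open>r S d p\<close> for the cost of the correspondences that contain the finite relation
  \<open>S\<close>. Call \<open>r\<close> an approximant if it lies between the window functions and \<open>f\<close>, is monotone in
  \<open>S\<close>, Borel in \<open>p\<close>, symmetric, and subadditive along composition of relations. The supremum of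
  the window functions is an approximant. Countable suprema of approximants are approximants, and so
  is the function obtained from an approximant by one back-and-forth step: the cost of enlarging \<open>S\<close>
  so that it covers a given finite set on one side, in the worst case over these sets.

  Scott analysis iterates this step through the countable ordinals until the values at the pair
  \<open>(d, d)\<close> stop growing. Ordinals can be avoided: at \<open>(d, d)\<close> there are only countably many
  values \<open>r S d d\<close>, and for each of them the supremum over all approximants is a supremum over
  countably many, so a single approximant \<open>r\<close> attains all these suprema (lemma
  \<open>exists_stable_approximant\<close>). A further step does not change it at \<open>(d, d)\<close>.

  Now let \<open>q\<close> be the result of two further steps. If \<open>q {} d p = 0\<close>, then the stability of \<open>r\<close>
  is carried over from \<open>(d, d)\<close> to \<open>(d, p)\<close>: there are relations \<open>T\<close> from \<open>p\<close> to \<open>d\<close> that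
  are defined on the range of \<open>S\<close> and have arbitrarily small cost, and then
  \<open>S \<subseteq> (S O T) O T\<inverse>\<close>, where \<open>S O T\<close> lives on \<open>(d, d)\<close> (lemma \<open>stability_transfers\<close>). Once a
  step does not raise \<open>r\<close> at \<open>(d, p)\<close>, a finite relation of cost below \<open>\<epsilon>\<close> can be enlarged for
  ever while its cost stays below \<open>\<epsilon>\<close>, and the union of these relations is a correspondence of cost
  at most \<open>\<epsilon>\<close> (lemma \<open>exists_correspondence_below\<close>). Conversely \<open>q\<close>, being an approximant, is
  at most \<open>f\<close> and vanishes where the distance does. Hence \<open>corr_dist X f d p = 0\<close> if and only if
  \<open>q {} d p = 0\<close>, and the latter condition is Borel in \<open>p\<close>.
\<close>

section \<open>Finite relations and the cost of enlarging them\<close>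

definition finite_rels :: "'x set \<Rightarrow> ('x \<times> 'x) set set"
  where "finite_rels X = {S. finite S \<and> S \<subseteq> X \<times> X}"

text \<open>
  The value of a one-round game: the opponent names a finite set \<open>E\<close>, and the answer is a finite
  extension of \<open>S\<close> that is defined on all of \<open>E\<close>. Asking for a whole finite set at once, rather
  than for a single point, makes one round enough in \<open>stability_transfers\<close>.
\<close>

definition covering_cost ::
  "'x set \<Rightarrow> (('x \<times> 'x) set \<Rightarrow> 'a \<Rightarrow> 'a \<Rightarrow> ennreal) \<Rightarrow> ('x \<times> 'x) set \<Rightarrow> 'a \<Rightarrow> 'a \<Rightarrow> ennreal"
  where "covering_cost X r S d p =
    (SUP E\<in>{E. finite E \<and> E \<subseteq> X}. INF T\<in>{T \<in> finite_rels X. S \<subseteq> T \<and> E \<subseteq> Domain T}. r T d p)"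

text \<open>
  The opponent may also ask for points to be covered in the range. This is put as a domain request
  for the converse relation, with the two points swapped, so that it is evidently symmetric and
  properties of \<^const>\<open>covering_cost\<close> need only be proved for domains.
\<close>

definition back_and_forth_step ::
  "'x set \<Rightarrow> (('x \<times> 'x) set \<Rightarrow> 'a \<Rightarrow> 'a \<Rightarrow> ennreal) \<Rightarrow> ('x \<times> 'x) set \<Rightarrow> 'a \<Rightarrow> 'a \<Rightarrow> ennreal"
  where "back_and_forth_step X r S d p =
    sup (covering_cost X r S d p) (covering_cost X r (S\<inverse>) p d)"

lemma finite_rels_empty: "{} \<in> finite_rels X"
  and finite_rels_converse: "S \<in> finite_rels X \<Longrightarrow> S\<inverse> \<in> finite_rels X"
  and finite_rels_relcomp: "S \<in> finite_rels X \<Longrightarrow> T \<in> finite_rels X \<Longrightarrow> S O T \<in> finite_rels X"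
  by (auto simp: finite_rels_def)

lemma countable_finite_rels: "countable X \<Longrightarrow> countable (finite_rels X)"
  unfolding finite_rels_def by (intro countable_Collect_finite_subset) auto

lemma correspondences_converse: "R \<in> correspondences X \<Longrightarrow> R\<inverse> \<in> correspondences X"
  unfolding correspondences_def by blast

lemma finite_rel_covering:
  assumes "S \<in> finite_rels X" "finite E" "E \<subseteq> X" "R \<in> correspondences X" "S \<subseteq> R"
  obtains T where "T \<in> finite_rels X" "S \<subseteq> T" "E \<subseteq> Domain T" "T \<subseteq> R"
proof -
  have "\<forall>x\<in>E. \<exists>y\<in>X. (x, y) \<in> R"
    using assms unfolding correspondences_def by blast
  then obtain h where "\<forall>x\<in>E. h x \<in> X \<and> (x, h x) \<in> R"
    by metis
  then have "S \<union> (\<lambda>x. (x, h x)) ` E \<in> finite_rels X" "E \<subseteq> Domain (S \<union> (\<lambda>x. (x, h x)) ` E)"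
    "S \<union> (\<lambda>x. (x, h x)) ` E \<subseteq> R"
    using assms unfolding finite_rels_def by auto
  then show thesis
    using that by blast
qed

text \<open>
  A correspondence \<open>R \<supseteq> S\<close> is a winning strategy in the game: it contains answers to all
  requests. This keeps the step below \<open>f\<close>.
\<close>

lemma covering_cost_le:
  assumes "S \<in> finite_rels X" "R \<in> correspondences X" "S \<subseteq> R"
    and "\<And>T. T \<in> finite_rels X \<Longrightarrow> T \<subseteq> R \<Longrightarrow> r T d p \<le> c"
  shows "covering_cost X r S d p \<le> c"
  unfolding covering_cost_def
proof (rule SUP_least, clarify)
  fix E assume "finite E" "E \<subseteq> X"
  then obtain T where "T \<in> finite_rels X" "S \<subseteq> T" "E \<subseteq> Domain T" "T \<subseteq> R"
    using finite_rel_covering[of S X E R] assms by blast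
  then show "(INF T\<in>{T \<in> finite_rels X. S \<subseteq> T \<and> E \<subseteq> Domain T}. r T d p) \<le> c"
    using assms(4) by (intro INF_lower2[of T]) auto
qed

lemma covering_cost_less:
  assumes "covering_cost X r S d p < c" "finite E" "E \<subseteq> X"
  obtains T where "T \<in> finite_rels X" "S \<subseteq> T" "E \<subseteq> Domain T" "r T d p < c"
proof -
  have "(INF T\<in>{T \<in> finite_rels X. S \<subseteq> T \<and> E \<subseteq> Domain T}. r T d p) \<le> covering_cost X r S d p"
    unfolding covering_cost_def using assms by (intro SUP_upper) auto
  then have "(INF T\<in>{T \<in> finite_rels X. S \<subseteq> T \<and> E \<subseteq> Domain T}. r T d p) < c"
    using assms by order
  then show thesis
    using that by (auto simp: INF_less_iff)
qed

text \<open>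
  Answers compose: answer the request \<open>E\<close> by some \<open>T \<supseteq> S\<close>, answer the request \<open>Range T\<close> by
  some \<open>T' \<supseteq> S'\<close>, and then \<open>T O T'\<close> is defined on \<open>E\<close>. A game with simultaneous requests on both
  sides would break this argument, since points in the range of \<open>T'\<close> need not be reached
  through \<open>T\<close>.
\<close>

lemma covering_cost_triangle:
  assumes "\<And>T T'. T \<in> finite_rels X \<Longrightarrow> T' \<in> finite_rels X \<Longrightarrow>
      r (T O T') d e \<le> r T d p + r T' p e"
  shows "covering_cost X r (S O S') d e \<le> covering_cost X r S d p + covering_cost X r S' p e"
    (is "_ \<le> ?a + ?b")
proof -
  have "(INF U\<in>{U \<in> finite_rels X. S O S' \<subseteq> U \<and> E \<subseteq> Domain U}. r U d e) \<le> ?a + ?b"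
    if E: "finite E" "E \<subseteq> X" for E
  proof (rule ennreal_le_epsilon)
    fix \<epsilon> :: real assume fin: "?a + ?b < top" and "0 < \<epsilon>"
    define \<delta> where "\<delta> = ennreal (\<epsilon> / 2)"
    have \<delta>: "0 < \<delta>" "\<delta> + \<delta> = ennreal \<epsilon>"
      using \<open>0 < \<epsilon>\<close> by (auto simp: \<delta>_def ennreal_plus[symmetric] simp del: ennreal_plus)
    have "?a < ?a + \<delta>" "?b < ?b + \<delta>"
      using fin \<delta> by (auto simp: ennreal_less_top less_top)
    obtain T where T: "T \<in> finite_rels X" "S \<subseteq> T" "E \<subseteq> Domain T" "r T d p < ?a + \<delta>"
      using covering_cost_less[OF \<open>?a < ?a + \<delta>\<close> E] .
    have "finite (Range T)" "Range T \<subseteq> X"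
      using T(1) by (auto simp: finite_rels_def finite_Range)
    then obtain T' where T': "T' \<in> finite_rels X" "S' \<subseteq> T'" "Range T \<subseteq> Domain T'"
        "r T' p e < ?b + \<delta>"
      using covering_cost_less[OF \<open>?b < ?b + \<delta>\<close>] by metis
    have "E \<subseteq> Domain (T O T')" "S O S' \<subseteq> T O T'"
      using T T' by blast+
    then have "(INF U\<in>{U \<in> finite_rels X. S O S' \<subseteq> U \<and> E \<subseteq> Domain U}. r U d e) \<le> r (T O T') d e"
      using finite_rels_relcomp[OF T(1) T'(1)] by (intro INF_lower) auto
    also have "\<dots> \<le> r T d p + r T' p e"
      using assms T(1) T'(1) .
    also have "\<dots> \<le> (?a + \<delta>) + (?b + \<delta>)"
      using T(4) T'(4) by (intro add_mono) auto
    also have "\<dots> = ?a + ?b + ennreal \<epsilon>"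
      by (simp add: \<delta>(2)[symmetric] ac_simps)
    finally show "(INF U\<in>{U \<in> finite_rels X. S O S' \<subseteq> U \<and> E \<subseteq> Domain U}. r U d e)
        \<le> ?a + ?b + ennreal \<epsilon>" .
  qed
  then show ?thesis
    unfolding covering_cost_def[of _ _ "S O S'"] by (intro SUP_least) auto
qed

lemma covering_cost_mono:
  "S \<subseteq> T \<Longrightarrow> covering_cost X r S d p \<le> covering_cost X r T d p"
  unfolding covering_cost_def by (intro SUP_mono' INF_superset_mono) auto

lemma le_covering_cost:
  assumes "\<And>T. T \<in> finite_rels X \<Longrightarrow> S \<subseteq> T \<Longrightarrow> r S d p \<le> r T d p"
  shows "r S d p \<le> covering_cost X r S d p"
  unfolding covering_cost_def by (rule SUP_upper2[of "{}"]) (auto intro!: INF_greatest assms)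

text \<open>
  Supremum and infimum range over finite subsets of a countable set, hence are countable. The
  variable \<open>z\<close> may enter through either point, as both occur in \<^const>\<open>back_and_forth_step\<close>.
\<close>

lemma borel_measurable_covering_cost:
  assumes "countable X" "\<And>T. T \<in> finite_rels X \<Longrightarrow> (\<lambda>z. r T (u z) (v z)) \<in> borel_measurable M"
  shows "(\<lambda>z. covering_cost X r S (u z) (v z)) \<in> borel_measurable M"
  unfolding covering_cost_def
proof (rule borel_measurable_SUP)
  show "countable {E. finite E \<and> E \<subseteq> X}"
    using \<open>countable X\<close> by (rule countable_Collect_finite_subset)
  show "(\<lambda>z. INF T\<in>{T \<in> finite_rels X. S \<subseteq> T \<and> E \<subseteq> Domain T}. r T (u z) (v z)) \<in> borel_measurable M"
    for E
  proof (rule borel_measurable_INF)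
    show "countable {T \<in> finite_rels X. S \<subseteq> T \<and> E \<subseteq> Domain T}"
      using countable_finite_rels[OF \<open>countable X\<close>] by (rule countable_subset[rotated]) auto
  qed (use assms in auto)
qed

section \<open>Window functions on arbitrary finite relations\<close>

locale approximated_correspondence_distance =
  fixes M :: "'a measure" and X :: "'x set"
    and f :: "('x \<times> 'x) set \<Rightarrow> 'a \<Rightarrow> 'a \<Rightarrow> ennreal"
    and g :: "'x set \<Rightarrow> 'x set \<Rightarrow> ('x \<times> 'x) set \<Rightarrow> 'a \<Rightarrow> 'a \<Rightarrow> ennreal"
  assumes countable_X: "countable X" and infinite_X: "infinite X"
    and mono: "window_monotone X (space M) g"
    and cont: "window_continuous X (space M) f g"
    and borel: "window_borel X M g"
    and symm: "window_symmetric X (space M) g"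
    and trans: "window_transitive X (space M) g"
begin

text \<open>
  Relating everything outside \<open>E \<times> F\<close> turns any relation into a correspondence with the same
  window: as \<open>X\<close> is infinite, a point outside \<open>F\<close> can serve as partner of every \<open>x\<close>, and a point outside \<open>E\<close>
  as partner of every \<open>y\<close>. Hence the conditions on the window functions, which speak of
  correspondences, apply to all relations on \<open>X\<close>.
\<close>

lemma window_extends_to_correspondence:
  assumes "finite E" "finite F" "S \<subseteq> X \<times> X"
  shows "rel_window S E F \<union> (X \<times> X - E \<times> F) \<in> correspondences X"
proof -
  have "X - E \<noteq> {}" "X - F \<noteq> {}"
    using infinite_X assms by (metis Diff_infinite_finite infinite_imp_nonempty)+
  then show ?thesis
    using \<open>S \<subseteq> X \<times> X\<close> unfolding correspondences_def rel_window_def by blast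
qed

lemma rel_window_extension:
  "rel_window (rel_window S E F \<union> (X \<times> X - E \<times> F)) E F = rel_window S E F"
  by (auto simp: rel_window_def)

lemma rel_window_in_correspondence_windows:
  assumes "finite E" "finite F" "S \<subseteq> X \<times> X"
  shows "rel_window S E F \<in> correspondence_windows X E F"
  unfolding correspondence_windows_def
  using window_extends_to_correspondence[OF assms] rel_window_extension[of S E F, symmetric] by blast

lemma window_value_mono:
  assumes "S \<subseteq> T" "T \<subseteq> X \<times> X" "finite E" "E \<subseteq> X" "finite F" "F \<subseteq> X" "d \<in> space M" "p \<in> space M"
  shows "g E F (rel_window S E F) d p \<le> g E F (rel_window T E F) d p"
proof -
  define ext where "ext = (\<lambda>S. rel_window S E F \<union> (X \<times> X - E \<times> F))"
  have "ext S \<in> correspondences X" "ext T \<in> correspondences X"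
    unfolding ext_def using assms by (auto intro!: window_extends_to_correspondence)
  moreover have "ext S \<subseteq> ext T"
    using assms by (auto simp: ext_def rel_window_def)
  ultimately have "g E F (rel_window (ext S) E F) d p \<le> g E F (rel_window (ext T) E F) d p"
    using mono assms unfolding window_monotone_def by blast
  then show ?thesis
    by (simp add: ext_def rel_window_extension)
qed

lemma window_value_symmetric:
  assumes "S \<subseteq> X \<times> X" "finite E" "E \<subseteq> X" "finite F" "F \<subseteq> X" "d \<in> space M" "p \<in> space M"
  shows "g E F (rel_window S E F) d p = g F E (rel_window (S\<inverse>) F E) p d"
proof -
  have "(rel_window S E F)\<inverse> = rel_window (S\<inverse>) F E"
    by (auto simp: rel_window_def)
  then show ?thesis
    using symm assms window_extends_to_correspondence[of E F S] rel_window_extension[of S E F]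
    unfolding window_symmetric_def by metis
qed

lemma window_value_triangle:
  assumes "S \<subseteq> X \<times> X" "T \<subseteq> X \<times> X" "Range S \<subseteq> F"
    and "finite E" "E \<subseteq> X" "finite F" "F \<subseteq> X" "finite G" "G \<subseteq> X"
    and "d \<in> space M" "p \<in> space M" "e \<in> space M"
  shows "g E G (rel_window (S O T) E G) d e
    \<le> g E F (rel_window S E F) d p + g F G (rel_window T F G) p e"
proof -
  define R where "R = rel_window S E F \<union> (X \<times> X - E \<times> F)"
  define R' where "R' = rel_window T F G \<union> (X \<times> X - F \<times> G)"
  have R: "R \<in> correspondences X" "rel_window R E F = rel_window S E F"
    "R' \<in> correspondences X" "rel_window R' F G = rel_window T F G"
    unfolding R_def R'_def using assms
    by (auto simp: rel_window_extension intro!: window_extends_to_correspondence)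
  have comp: "rel_window R E F O rel_window R' F G = rel_window (S O T) E G"
    unfolding R using \<open>Range S \<subseteq> F\<close> by (auto simp: rel_window_def)
  have "S O T \<subseteq> X \<times> X"
    using assms(1,2) by blast
  then have "rel_window R E F O rel_window R' F G \<in> correspondence_windows X E G"
    unfolding comp using assms by (intro rel_window_in_correspondence_windows)
  then have "g E G (rel_window R E F O rel_window R' F G) d e
      \<le> g E F (rel_window R E F) d p + g F G (rel_window R' F G) p e"
    using R(1,3) assms by (intro trans[unfolded window_transitive_def, rule_format]) auto
  then show ?thesis
    unfolding comp unfolding R .
qed

text \<open>
  The formula for \<open>f\<close> in the continuity condition, evaluated at relations that need not be
  correspondences. It is the first approximant.
\<close>

definition window_sup :: "('x \<times> 'x) set \<Rightarrow> 'a \<Rightarrow> 'a \<Rightarrow> ennreal"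
  where "window_sup S d p =
    (SUP (E, F)\<in>{E. finite E \<and> E \<subseteq> X} \<times> {F. finite F \<and> F \<subseteq> X}. g E F (rel_window S E F) d p)"

lemma window_sup_upper:
  assumes "finite E" "E \<subseteq> X" "finite F" "F \<subseteq> X"
  shows "g E F (rel_window S E F) d p \<le> window_sup S d p"
  unfolding window_sup_def using assms by (intro SUP_upper2[of "(E, F)"]) auto

lemma window_sup_least:
  assumes "\<And>E F. finite E \<Longrightarrow> E \<subseteq> X \<Longrightarrow> finite F \<Longrightarrow> F \<subseteq> X \<Longrightarrow> g E F (rel_window S E F) d p \<le> c"
  shows "window_sup S d p \<le> c"
  unfolding window_sup_def using assms by (intro SUP_least) auto

lemma f_eq_window_sup:
  "R \<in> correspondences X \<Longrightarrow> d \<in> space M \<Longrightarrow> p \<in> space M \<Longrightarrow> f R d p = window_sup R d p"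
  using cont unfolding window_continuous_def window_sup_def by blast

lemma window_sup_mono:
  assumes "S \<subseteq> T" "T \<subseteq> X \<times> X" "d \<in> space M" "p \<in> space M"
  shows "window_sup S d p \<le> window_sup T d p"
  using assms by (intro window_sup_least order_trans[OF window_value_mono window_sup_upper])

lemma window_sup_converse_le:
  assumes "S \<subseteq> X \<times> X" "d \<in> space M" "p \<in> space M"
  shows "window_sup S d p \<le> window_sup (S\<inverse>) p d"
proof (rule window_sup_least)
  fix E F assume EF: "finite E" "E \<subseteq> X" "finite F" "F \<subseteq> X"
  then have "g E F (rel_window S E F) d p = g F E (rel_window (S\<inverse>) F E) p d"
    using assms by (intro window_value_symmetric)
  also have "\<dots> \<le> window_sup (S\<inverse>) p d"
    using EF by (intro window_sup_upper)
  finally show "g E F (rel_window S E F) d p \<le> window_sup (S\<inverse>) p d" .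
qed

section \<open>Approximants\<close>

text \<open>
  The class of candidates for a stable estimate. The lower bound by the window functions makes a
  union of cheap finite relations cheap for \<open>f\<close>; the upper bound by \<open>f\<close> makes the estimate vanish
  at distance \<open>0\<close>; symmetry, subadditivity and monotonicity carry stability from one pair of points
  to another.
\<close>

definition approximant :: "(('x \<times> 'x) set \<Rightarrow> 'a \<Rightarrow> 'a \<Rightarrow> ennreal) \<Rightarrow> bool"
  where "approximant r \<longleftrightarrow>
    (\<forall>S\<in>finite_rels X. \<forall>d\<in>space M. r S d \<in> borel_measurable M) \<and>
    (\<forall>S\<in>finite_rels X. \<forall>d\<in>space M. \<forall>p\<in>space M. r S d p = r (S\<inverse>) p d) \<and>
    (\<forall>S\<in>finite_rels X. \<forall>T\<in>finite_rels X. \<forall>d\<in>space M. \<forall>p\<in>space M. \<forall>e\<in>space M.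
      r (S O T) d e \<le> r S d p + r T p e) \<and>
    (\<forall>S\<in>finite_rels X. \<forall>T\<in>finite_rels X. \<forall>d\<in>space M. \<forall>p\<in>space M.
      S \<subseteq> T \<longrightarrow> r S d p \<le> r T d p) \<and>
    (\<forall>S\<in>finite_rels X. \<forall>d\<in>space M. \<forall>p\<in>space M. \<forall>E F.
      finite E \<and> E \<subseteq> X \<and> finite F \<and> F \<subseteq> X \<longrightarrow> g E F (rel_window S E F) d p \<le> r S d p) \<and>
    (\<forall>S\<in>finite_rels X. \<forall>R\<in>correspondences X. \<forall>d\<in>space M. \<forall>p\<in>space M.
      S \<subseteq> R \<longrightarrow> r S d p \<le> f R d p)"

lemma approximantD:
  assumes "approximant r" "S \<in> finite_rels X" "d \<in> space M"
  shows "r S d \<in> borel_measurable M"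
    and "p \<in> space M \<Longrightarrow> r S d p = r (S\<inverse>) p d"
    and "T \<in> finite_rels X \<Longrightarrow> p \<in> space M \<Longrightarrow> e \<in> space M \<Longrightarrow> r (S O T) d e \<le> r S d p + r T p e"
    and "T \<in> finite_rels X \<Longrightarrow> p \<in> space M \<Longrightarrow> S \<subseteq> T \<Longrightarrow> r S d p \<le> r T d p"
    and "p \<in> space M \<Longrightarrow> finite E \<Longrightarrow> E \<subseteq> X \<Longrightarrow> finite F \<Longrightarrow> F \<subseteq> X \<Longrightarrow>
      g E F (rel_window S E F) d p \<le> r S d p"
    and "R \<in> correspondences X \<Longrightarrow> p \<in> space M \<Longrightarrow> S \<subseteq> R \<Longrightarrow> r S d p \<le> f R d p"
proof -
  note r = assms(1)[unfolded approximant_def]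
  note r1 = r[THEN conjunct1] and r = r[THEN conjunct2]
  note r2 = r[THEN conjunct1] and r = r[THEN conjunct2]
  note r3 = r[THEN conjunct1] and r = r[THEN conjunct2]
  note r4 = r[THEN conjunct1] and r = r[THEN conjunct2]
  note r5 = r[THEN conjunct1] and r6 = r[THEN conjunct2]
  show "r S d \<in> borel_measurable M"
    using r1 assms by blast
  show "p \<in> space M \<Longrightarrow> r S d p = r (S\<inverse>) p d"
    using r2 assms by blast
  show "T \<in> finite_rels X \<Longrightarrow> p \<in> space M \<Longrightarrow> e \<in> space M \<Longrightarrow> r (S O T) d e \<le> r S d p + r T p e"
    using r3 assms by blast
  show "T \<in> finite_rels X \<Longrightarrow> p \<in> space M \<Longrightarrow> S \<subseteq> T \<Longrightarrow> r S d p \<le> r T d p"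
    using r4 assms by blast
  show "p \<in> space M \<Longrightarrow> finite E \<Longrightarrow> E \<subseteq> X \<Longrightarrow> finite F \<Longrightarrow> F \<subseteq> X \<Longrightarrow>
      g E F (rel_window S E F) d p \<le> r S d p"
    using r5 assms by blast
  show "R \<in> correspondences X \<Longrightarrow> p \<in> space M \<Longrightarrow> S \<subseteq> R \<Longrightarrow> r S d p \<le> f R d p"
    using r6 assms by blast
qed

lemma approximant_window_sup: "approximant window_sup"
  unfolding approximant_def
proof (intro conjI ballI allI impI)
  fix S d assume S: "S \<in> finite_rels X" and d: "d \<in> space M"
  have "(\<lambda>p. case EF of (E, F) \<Rightarrow> g E F (rel_window S E F) d p) \<in> borel_measurable M"
    if "EF \<in> {E. finite E \<and> E \<subseteq> X} \<times> {F. finite F \<and> F \<subseteq> X}" for EF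
    using that borel rel_window_in_correspondence_windows[of _ _ S] S d
    unfolding window_borel_def finite_rels_def by auto
  then show "window_sup S d \<in> borel_measurable M"
    unfolding window_sup_def[abs_def]
    by (intro borel_measurable_SUP countable_SIGMA countable_Collect_finite_subset countable_X)
next
  fix S d p assume "S \<in> finite_rels X" and dp: "d \<in> space M" "p \<in> space M"
  then have "S \<subseteq> X \<times> X" "S\<inverse> \<subseteq> X \<times> X"
    by (auto simp: finite_rels_def)
  then show "window_sup S d p = window_sup (S\<inverse>) p d"
    using window_sup_converse_le[of S d p] window_sup_converse_le[of "S\<inverse>" p d] dp
    by simp
next
  fix S T d p e
  assume ST: "S \<in> finite_rels X" "T \<in> finite_rels X"
    and dpe: "d \<in> space M" "p \<in> space M" "e \<in> space M"
  show "window_sup (S O T) d e \<le> window_sup S d p + window_sup T p e"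
  proof (rule window_sup_least)
    \<comment> \<open>With the middle window \<open>Range S\<close> no intermediate point is lost in the composition.\<close>
    fix E G assume EG: "finite E" "E \<subseteq> X" "finite G" "G \<subseteq> X"
    have F: "finite (Range S)" "Range S \<subseteq> X"
      using ST by (auto simp: finite_rels_def finite_Range)
    have "g E G (rel_window (S O T) E G) d e
        \<le> g E (Range S) (rel_window S E (Range S)) d p + g (Range S) G (rel_window T (Range S) G) p e"
      using ST EG F dpe by (intro window_value_triangle) (auto simp: finite_rels_def)
    also have "\<dots> \<le> window_sup S d p + window_sup T p e"
      using EG F by (intro add_mono window_sup_upper)
    finally show "g E G (rel_window (S O T) E G) d e \<le> window_sup S d p + window_sup T p e" .
  qed
next
  fix S T d p assume "S \<in> finite_rels X" "T \<in> finite_rels X" "d \<in> space M" "p \<in> space M" "S \<subseteq> T"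
  then show "window_sup S d p \<le> window_sup T d p"
    by (intro window_sup_mono) (auto simp: finite_rels_def)
next
  fix S d p E F assume "finite E \<and> E \<subseteq> X \<and> finite F \<and> F \<subseteq> X"
  then show "g E F (rel_window S E F) d p \<le> window_sup S d p"
    by (intro window_sup_upper) auto
next
  fix S R d p assume "R \<in> correspondences X" "d \<in> space M" "p \<in> space M" "S \<subseteq> R"
  then show "window_sup S d p \<le> f R d p"
    by (simp add: f_eq_window_sup window_sup_mono correspondences_def)
qed

lemma approximant_SUP:
  assumes "countable I" "I \<noteq> {}" and r: "\<And>i. i \<in> I \<Longrightarrow> approximant (r i)"
  shows "approximant (\<lambda>S d p. SUP i\<in>I. r i S d p)"
proof -
  obtain i0 where "i0 \<in> I"
    using assms by blast
  show ?thesis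
    unfolding approximant_def
  proof (intro conjI ballI allI impI)
    fix S d assume "S \<in> finite_rels X" "d \<in> space M"
    then show "(\<lambda>p. SUP i\<in>I. r i S d p) \<in> borel_measurable M"
      using assms by (intro borel_measurable_SUP) (auto intro: approximantD(1))
  next
    fix S d p assume "S \<in> finite_rels X" "d \<in> space M" "p \<in> space M"
    then have "r i S d p = r i (S\<inverse>) p d" if "i \<in> I" for i
      using approximantD(2)[OF r[OF that]] by blast
    then show "(SUP i\<in>I. r i S d p) = (SUP i\<in>I. r i (S\<inverse>) p d)"
      by (intro SUP_cong refl)
  next
    fix S T d p e
    assume prems: "S \<in> finite_rels X" "T \<in> finite_rels X" "d \<in> space M" "p \<in> space M" "e \<in> space M"
    show "(SUP i\<in>I. r i (S O T) d e) \<le> (SUP i\<in>I. r i S d p) + (SUP i\<in>I. r i T p e)"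
    proof (rule SUP_least)
      fix i assume "i \<in> I"
      then have "r i (S O T) d e \<le> r i S d p + r i T p e"
        using prems r by (intro approximantD(3))
      also have "\<dots> \<le> (SUP i\<in>I. r i S d p) + (SUP i\<in>I. r i T p e)"
        using \<open>i \<in> I\<close> by (intro add_mono SUP_upper)
      finally show "r i (S O T) d e \<le> (SUP i\<in>I. r i S d p) + (SUP i\<in>I. r i T p e)" .
    qed
  next
    fix S T d p assume "S \<in> finite_rels X" "T \<in> finite_rels X" "d \<in> space M" "p \<in> space M" "S \<subseteq> T"
    then have "r i S d p \<le> r i T d p" if "i \<in> I" for i
      using approximantD(4)[OF r[OF that]] by blast
    then show "(SUP i\<in>I. r i S d p) \<le> (SUP i\<in>I. r i T d p)"
      by (intro SUP_mono) blast
  next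
    fix S d p E F assume "S \<in> finite_rels X" "d \<in> space M" "p \<in> space M"
      "finite E \<and> E \<subseteq> X \<and> finite F \<and> F \<subseteq> X"
    then show "g E F (rel_window S E F) d p \<le> (SUP i\<in>I. r i S d p)"
      using r \<open>i0 \<in> I\<close> by (intro SUP_upper2[of i0] approximantD(5)) auto
  next
    fix S R d p assume "S \<in> finite_rels X" "R \<in> correspondences X" "d \<in> space M" "p \<in> space M" "S \<subseteq> R"
    then show "(SUP i\<in>I. r i S d p) \<le> f R d p"
      using r by (intro SUP_least approximantD(6)) auto
  qed
qed

lemma le_back_and_forth_step:
  assumes "approximant r" "S \<in> finite_rels X" "d \<in> space M" "p \<in> space M"
  shows "r S d p \<le> back_and_forth_step X r S d p"
proof -
  have "r S d p \<le> covering_cost X r S d p"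
    using approximantD(4)[OF assms(1-3)] assms(4) by (intro le_covering_cost) auto
  then show ?thesis
    by (simp add: back_and_forth_step_def le_supI1)
qed

lemma approximant_back_and_forth_step:
  assumes r: "approximant r"
  shows "approximant (back_and_forth_step X r)"
  unfolding approximant_def
proof (intro conjI ballI allI impI)
  fix S d assume S: "S \<in> finite_rels X" and d: "d \<in> space M"
  have "(\<lambda>p. r T d p) \<in> borel_measurable M" if "T \<in> finite_rels X" for T
    using approximantD(1)[OF r that d] .
  moreover have "(\<lambda>p. r T p d) \<in> borel_measurable M" if "T \<in> finite_rels X" for T
  proof -
    have "(\<lambda>p. r T p d) \<in> borel_measurable M \<longleftrightarrow> r (T\<inverse>) d \<in> borel_measurable M"
      using approximantD(2)[OF r that _ d] by (intro measurable_cong)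
    then show ?thesis
      using approximantD(1)[OF r finite_rels_converse[OF that] d] by simp
  qed
  ultimately show "back_and_forth_step X r S d \<in> borel_measurable M"
    unfolding back_and_forth_step_def[abs_def] using countable_X
    by (intro borel_measurable_sup borel_measurable_covering_cost)
next
  fix S d p
  show "back_and_forth_step X r S d p = back_and_forth_step X r (S\<inverse>) p d"
    by (simp add: back_and_forth_step_def sup_commute)
next
  fix S T d p e
  assume "S \<in> finite_rels X" "T \<in> finite_rels X" and dpe: "d \<in> space M" "p \<in> space M" "e \<in> space M"
  let ?bound = "back_and_forth_step X r S d p + back_and_forth_step X r T p e"
  have "covering_cost X r (S O T) d e \<le> covering_cost X r S d p + covering_cost X r T p e"
    using r dpe by (intro covering_cost_triangle approximantD(3))
  also have "\<dots> \<le> ?bound"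
    unfolding back_and_forth_step_def by (intro add_mono sup_ge1)
  finally have "covering_cost X r (S O T) d e \<le> ?bound" .
  moreover have "covering_cost X r (T\<inverse> O S\<inverse>) e d
      \<le> covering_cost X r (S\<inverse>) p d + covering_cost X r (T\<inverse>) e p"
    unfolding add.commute[of "covering_cost X r (S\<inverse>) p d"]
    using r dpe by (intro covering_cost_triangle approximantD(3))
  moreover have "\<dots> \<le> ?bound"
    unfolding back_and_forth_step_def by (intro add_mono sup_ge2)
  ultimately show "back_and_forth_step X r (S O T) d e \<le> ?bound"
    unfolding back_and_forth_step_def[of X r "S O T"] converse_relcomp by (intro sup_least) order+
next
  fix S T :: "('x \<times> 'x) set" and d p assume "S \<subseteq> T"
  then show "back_and_forth_step X r S d p \<le> back_and_forth_step X r T d p"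
    unfolding back_and_forth_step_def by (intro sup_mono covering_cost_mono) auto
next
  fix S d p E F
  assume S: "S \<in> finite_rels X" and dp: "d \<in> space M" "p \<in> space M"
    and EF: "finite E \<and> E \<subseteq> X \<and> finite F \<and> F \<subseteq> X"
  have "g E F (rel_window S E F) d p \<le> r S d p"
    using approximantD(5)[OF r S] dp EF by blast
  also have "\<dots> \<le> back_and_forth_step X r S d p"
    using r S dp by (rule le_back_and_forth_step)
  finally show "g E F (rel_window S E F) d p \<le> back_and_forth_step X r S d p" .
next
  fix S R d p
  assume S: "S \<in> finite_rels X" and R: "R \<in> correspondences X" and dp: "d \<in> space M" "p \<in> space M"
    and "S \<subseteq> R"
  have "covering_cost X r S d p \<le> f R d p"
    using approximantD(6)[OF r] R dp by (intro covering_cost_le[OF S R \<open>S \<subseteq> R\<close>]) auto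
  moreover have "covering_cost X r (S\<inverse>) p d \<le> f R d p"
  proof (rule covering_cost_le)
    show "S\<inverse> \<in> finite_rels X" "R\<inverse> \<in> correspondences X" "S\<inverse> \<subseteq> R\<inverse>"
      using S R \<open>S \<subseteq> R\<close> by (auto intro: finite_rels_converse correspondences_converse)
    fix T assume T: "T \<in> finite_rels X" "T \<subseteq> R\<inverse>"
    then have "r (T\<inverse>) d p \<le> f R d p"
      using R dp by (intro approximantD(6)[OF r] finite_rels_converse) auto
    then show "r T p d \<le> f R d p"
      using approximantD(2)[OF r T(1)] dp by simp
  qed
  ultimately show "back_and_forth_step X r S d p \<le> f R d p"
    by (simp add: back_and_forth_step_def)
qed

section \<open>An approximant that is stable at one point\<close>

text \<open>
  This replaces a transfinite iteration of the step. For each of the countably many finite relations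
  \<open>S\<close> a sequence of approximants reaches the supremum of all values at \<open>(S, d, d)\<close>; the
  supremum \<open>r\<close> of all these sequences is an approximant, so it attains all these suprema. The step
  applied to \<open>r\<close> is an approximant as well and cannot exceed them.
\<close>

lemma exists_stable_approximant:
  obtains r where "approximant r"
    and "\<And>S. S \<in> finite_rels X \<Longrightarrow> back_and_forth_step X r S d d \<le> r S d d"
proof -
  have "\<exists>h. (\<forall>n::nat. approximant (h n)) \<and> (\<forall>r. approximant r \<longrightarrow> r S d d \<le> (SUP n. h n S d d))" for S
  proof -
    have "{r. approximant r} \<noteq> {}"
      using approximant_window_sup by blast
    from ennreal_SUP_countable_SUP[OF this, of "\<lambda>r. r S d d"]
    obtain c :: "nat \<Rightarrow> ennreal" where c: "range c \<subseteq> (\<lambda>r. r S d d) ` {r. approximant r}"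
      "(SUP r\<in>{r. approximant r}. r S d d) = (SUP n. c n)"
      by blast
    then have "\<forall>n. \<exists>r. approximant r \<and> c n = r S d d"
      by blast
    then obtain h where h: "\<And>n. approximant (h n)" "\<And>n. c n = h n S d d"
      by metis
    have "r S d d \<le> (SUP n. h n S d d)" if "approximant r" for r
      using c(2) that unfolding h(2) by (metis SUP_upper mem_Collect_eq)
    then show ?thesis
      using h(1) by blast
  qed
  then obtain h where h: "\<And>S n. approximant (h S (n::nat))"
    "\<And>S r. approximant r \<Longrightarrow> r S d d \<le> (SUP n. h S n S d d)"
    by metis
  define r where "r = (\<lambda>S' d' p. SUP (S, n)\<in>finite_rels X \<times> UNIV. h S n S' d' p)"
  have "approximant r"
  proof -
    have "approximant (\<lambda>S' d' p. SUP i\<in>finite_rels X \<times> UNIV. h (fst i) (snd i) S' d' p)"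
      using h(1) countable_finite_rels[OF countable_X] finite_rels_empty
      by (intro approximant_SUP) auto
    then show ?thesis
      by (simp add: r_def case_prod_unfold)
  qed
  moreover have "back_and_forth_step X r S d d \<le> r S d d" if "S \<in> finite_rels X" for S
  proof -
    have "back_and_forth_step X r S d d \<le> (SUP n. h S n S d d)"
      using approximant_back_and_forth_step[OF \<open>approximant r\<close>] by (rule h(2))
    also have "\<dots> \<le> r S d d"
      unfolding r_def using that by (intro SUP_least) (auto intro!: SUP_upper2[of "(S, _)"])
    finally show ?thesis .
  qed
  ultimately show thesis
    using that by blast
qed

text \<open>
  As in the classical argument that a Scott rank of one structure serves for all structures which
  resemble it closely enough. The relation \<open>S\<close> between \<open>d\<close> and \<open>p\<close> is moved to \<open>S O T\<close> on
  \<open>(d, d)\<close>, where stability is known, and moved back with \<open>T\<inverse>\<close>. The vanishing of the twofold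
  step is used for the cost of \<open>T\<close> after one step, since the way back is measured after one step.
\<close>

lemma stability_transfers:
  assumes r: "approximant r" and S: "S \<in> finite_rels X" and dp: "d \<in> space M" "p \<in> space M"
    and stable: "\<And>S. S \<in> finite_rels X \<Longrightarrow> back_and_forth_step X r S d d \<le> r S d d"
    and zero: "back_and_forth_step X (back_and_forth_step X r) {} d p = 0"
  shows "back_and_forth_step X r S d p \<le> r S d p"
proof (rule ennreal_le_epsilon)
  let ?r' = "back_and_forth_step X r"
  have r': "approximant ?r'"
    using r by (rule approximant_back_and_forth_step)
  fix \<epsilon> :: real assume "0 < \<epsilon>"
  define \<delta> where "\<delta> = ennreal (\<epsilon> / 2)"
  have \<delta>: "0 < \<delta>" "\<delta> + \<delta> = ennreal \<epsilon>"
    using \<open>0 < \<epsilon>\<close> by (auto simp: \<delta>_def ennreal_plus[symmetric] simp del: ennreal_plus)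
  have "covering_cost X ?r' {} p d \<le> back_and_forth_step X ?r' {} d p"
    by (simp add: back_and_forth_step_def)
  then have "covering_cost X ?r' {} p d < \<delta>"
    using zero \<open>0 < \<delta>\<close> by simp
  moreover have "finite (Range S)" "Range S \<subseteq> X"
    using S by (auto simp: finite_rels_def finite_Range)
  ultimately obtain T where T: "T \<in> finite_rels X" "Range S \<subseteq> Domain T" "?r' T p d < \<delta>"
    by (rule covering_cost_less)
  have T': "T\<inverse> \<in> finite_rels X" "S O T \<in> finite_rels X" "(S O T) O T\<inverse> \<in> finite_rels X"
    using S T(1) by (auto intro: finite_rels_converse finite_rels_relcomp)
  have "r T p d \<le> \<delta>"
    using le_back_and_forth_step[OF r T(1) dp(2,1)] T(3) by order
  have "?r' (S O T) d d \<le> r (S O T) d d"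
    using T' by (intro stable)
  also have "\<dots> \<le> r S d p + r T p d"
    using r S T(1) dp by (intro approximantD(3))
  also have "\<dots> \<le> r S d p + \<delta>"
    using \<open>r T p d \<le> \<delta>\<close> by (intro add_left_mono)
  finally have dd: "?r' (S O T) d d \<le> r S d p + \<delta>" .
  have "?r' (T\<inverse>) d p = ?r' T p d"
    using approximantD(2)[OF r' T(1)] dp by simp
  then have dp': "?r' (T\<inverse>) d p \<le> \<delta>"
    using T(3) by simp
  have "S \<subseteq> (S O T) O T\<inverse>"
    using T(2) by fast
  then have "?r' S d p \<le> ?r' ((S O T) O T\<inverse>) d p"
    using r' S T' dp by (intro approximantD(4))
  also have "\<dots> \<le> ?r' (S O T) d d + ?r' (T\<inverse>) d p"
    using r' T' dp by (intro approximantD(3))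
  also have "\<dots> \<le> (r S d p + \<delta>) + \<delta>"
    using dd dp' by (rule add_mono)
  also have "\<dots> = r S d p + ennreal \<epsilon>"
    by (simp add: \<delta>(2)[symmetric] ac_simps)
  finally show "?r' S d p \<le> r S d p + ennreal \<epsilon>" .
qed

section \<open>Back and forth\<close>

text \<open>
  The inequality \<open>r S d p < c\<close> is an invariant under which every request can be answered, so an
  enumeration of \<open>X\<close> leads to an increasing sequence of finite relations whose union is a
  correspondence. A finite window sees only finitely many pairs of the union, hence only one member
  of the sequence, and is therefore bounded by \<open>c\<close>.
\<close>

lemma exists_correspondence_below:
  assumes r: "approximant r" and dp: "d \<in> space M" "p \<in> space M"
    and stable: "\<And>S. S \<in> finite_rels X \<Longrightarrow> back_and_forth_step X r S d p \<le> r S d p"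
    and "r {} d p < c"
  obtains R where "R \<in> correspondences X" "f R d p \<le> c"
proof -
  define E where "E n = from_nat_into X ` {..n}" for n :: nat
  have "X \<noteq> {}"
    using infinite_X by auto
  then have E: "finite (E n)" "E n \<subseteq> X" for n
    using from_nat_into[OF \<open>X \<noteq> {}\<close>] by (auto simp: E_def)
  \<comment> \<open>A domain request gives \<open>T\<close>, then a range request, answered on the converse, gives \<open>U\<close>.\<close>
  have step: "\<exists>U. (U \<in> finite_rels X \<and> r U d p < c) \<and> S \<subseteq> U \<and> E n \<subseteq> Domain U \<and> E n \<subseteq> Range U"
    if S: "S \<in> finite_rels X \<and> r S d p < c" for S n
  proof -
    have "covering_cost X r S d p < c"
      using stable[of S] S by (auto simp: back_and_forth_step_def)
    from covering_cost_less[OF this E] obtain T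
      where T: "T \<in> finite_rels X" "S \<subseteq> T" "E n \<subseteq> Domain T" "r T d p < c" .
    have "covering_cost X r (T\<inverse>) p d < c"
      using stable[of T] T by (auto simp: back_and_forth_step_def)
    from covering_cost_less[OF this E] obtain U
      where U: "U \<in> finite_rels X" "T\<inverse> \<subseteq> U" "E n \<subseteq> Domain U" "r U p d < c" .
    have "r (U\<inverse>) d p < c"
      using U approximantD(2)[OF r U(1)] dp by simp
    moreover have "T \<subseteq> U\<inverse>" "Domain T \<subseteq> Domain (U\<inverse>)"
      using U(2) by auto
    ultimately show ?thesis
      using T(2,3) U(1,3) by (intro exI[of _ "U\<inverse>"]) (auto intro: finite_rels_converse)
  qed
  have "\<exists>s. \<forall>n. (s n \<in> finite_rels X \<and> r (s n) d p < c) \<and>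
      (s n \<subseteq> s (Suc n) \<and> E n \<subseteq> Domain (s (Suc n)) \<and> E n \<subseteq> Range (s (Suc n)))"
    using step finite_rels_empty[of X] \<open>r {} d p < c\<close> by (intro dependent_nat_choice) blast+
  then obtain s where s: "\<And>n. s n \<in> finite_rels X" "\<And>n. r (s n) d p < c"
    "\<And>n. s n \<subseteq> s (Suc n)" "\<And>n. E n \<subseteq> Domain (s (Suc n))" "\<And>n. E n \<subseteq> Range (s (Suc n))"
    by blast
  have "incseq s"
    using s(3) by (rule incseq_SucI)
  have in_E: "\<exists>n. x \<in> E n" if "x \<in> X" for x
    using from_nat_into_to_nat_on[OF countable_X that] unfolding E_def
    by (intro exI[of _ "to_nat_on X x"]) force
  let ?R = "\<Union>n. s n"
  have "?R \<subseteq> X \<times> X"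
    using s(1) by (auto simp: finite_rels_def)
  have R: "?R \<in> correspondences X"
    unfolding correspondences_def
  proof (intro CollectI conjI ballI)
    fix x assume "x \<in> X"
    then obtain n where "x \<in> E n"
      using in_E by blast
    then have "x \<in> Domain (s (Suc n))" "x \<in> Range (s (Suc n))"
      using s(4,5) by blast+
    then show "\<exists>y\<in>X. (x, y) \<in> ?R" "\<exists>y\<in>X. (y, x) \<in> ?R"
      using \<open>?R \<subseteq> X \<times> X\<close> by blast+
  qed fact
  have "window_sup ?R d p \<le> c"
  proof (rule window_sup_least)
    fix A B assume AB: "finite A" "A \<subseteq> X" "finite B" "B \<subseteq> X"
    have "finite (rel_window ?R A B)"
      by (rule finite_subset[of _ "A \<times> B"]) (auto simp: rel_window_def AB)
    moreover have "rel_window ?R A B \<subseteq> ?R"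
      by (auto simp: rel_window_def)
    moreover have "subset.chain UNIV (range s)"
    proof -
      have "s m \<subseteq> s n \<or> s n \<subseteq> s m" for m n
        using incseqD[OF \<open>incseq s\<close>] nat_le_linear[of m n] by blast
      then show ?thesis
        unfolding subset.chain_def by blast
    qed
    ultimately obtain n where "rel_window ?R A B \<subseteq> s n"
      using finite_subset_Union_chain[of "rel_window ?R A B" "range s" UNIV] by blast
    then have "rel_window ?R A B = rel_window (s n) A B"
      by (auto simp: rel_window_def)
    then have "g A B (rel_window ?R A B) d p \<le> r (s n) d p"
      using approximantD(5)[OF r s(1)] AB dp by simp
    then show "g A B (rel_window ?R A B) d p \<le> c"
      using s(2)[of n] by order
  qed
  then show thesis
    using that[OF R] f_eq_window_sup[OF R dp] by simp
qed

theorem zero_distance_set_borel: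
  assumes d: "d \<in> space M"
  shows "{p \<in> space M. corr_dist X f d p = 0} \<in> sets M"
proof -
  obtain r where r: "approximant r"
    and stable: "\<And>S. S \<in> finite_rels X \<Longrightarrow> back_and_forth_step X r S d d \<le> r S d d"
    using exists_stable_approximant[of d] by blast
  let ?q = "back_and_forth_step X (back_and_forth_step X r)"
  have q: "approximant ?q"
    using r by (intro approximant_back_and_forth_step)
  have "corr_dist X f d p = 0 \<longleftrightarrow> ?q {} d p = 0" if p: "p \<in> space M" for p
  proof
    have "?q {} d p \<le> corr_dist X f d p"
      unfolding corr_dist_def using approximantD(6)[OF q finite_rels_empty d _ p]
      by (intro INF_greatest) auto
    then show "corr_dist X f d p = 0 \<Longrightarrow> ?q {} d p = 0"
      by simp
  next
    assume zero: "?q {} d p = 0"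
    have stable': "back_and_forth_step X r S d p \<le> r S d p" if "S \<in> finite_rels X" for S
      using stability_transfers[OF r that d p stable zero] .
    have "r {} d p \<le> back_and_forth_step X r {} d p"
      using r finite_rels_empty d p by (rule le_back_and_forth_step)
    also have "\<dots> \<le> ?q {} d p"
      using approximant_back_and_forth_step[OF r] finite_rels_empty d p
      by (rule le_back_and_forth_step)
    finally have "r {} d p = 0"
      using zero by simp
    have "corr_dist X f d p \<le> c" if c: "0 < c" for c
    proof -
      obtain R where "R \<in> correspondences X" "f R d p \<le> c"
        using exists_correspondence_below[OF r d p stable'] \<open>r {} d p = 0\<close> c by metis
      then show ?thesis
        unfolding corr_dist_def by (intro INF_lower2)
    qed
    then show "corr_dist X f d p = 0"
      by (metis not_gr_zero dense not_le)
  qed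
  then have "{p \<in> space M. corr_dist X f d p = 0} = {p \<in> space M. ?q {} d p = 0}"
    by auto
  also have "\<dots> \<in> sets M"
    using approximantD(1)[OF q finite_rels_empty d] by measurable
  finally show ?thesis .
qed

end

section \<open>Finite sets and conclusion\<close>

text \<open>
  For finite \<open>X\<close> the extension of windows to correspondences breaks down, but there are only
  finitely many correspondences, and \<open>f R d\<close> is Borel as a countable supremum of window functions.
\<close>

lemma borel_measurable_corr_dist_finite:
  assumes "finite X" "window_continuous X (space M) f g" "window_borel X M g" "d \<in> space M"
  shows "corr_dist X f d \<in> borel_measurable M"
proof -
  have borel: "(\<lambda>p. f R d p) \<in> borel_measurable M" if R: "R \<in> correspondences X" for R
  proof -
    have "(\<lambda>p. SUP (E, F)\<in>{E. finite E \<and> E \<subseteq> X} \<times> {F. finite F \<and> F \<subseteq> X}. g E F (rel_window R E F) d p)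
        \<in> borel_measurable M"
    proof (rule borel_measurable_SUP)
      show "countable ({E. finite E \<and> E \<subseteq> X} \<times> {F. finite F \<and> F \<subseteq> X})"
        using \<open>finite X\<close> by (intro countable_SIGMA countable_Collect_finite_subset countable_finite)
      show "(\<lambda>p. case EF of (E, F) \<Rightarrow> g E F (rel_window R E F) d p) \<in> borel_measurable M"
        if "EF \<in> {E. finite E \<and> E \<subseteq> X} \<times> {F. finite F \<and> F \<subseteq> X}" for EF
      proof -
        have "rel_window R E F \<in> correspondence_windows X E F" for E F
          using R by (auto simp: correspondence_windows_def)
        then show ?thesis
          using that assms(3,4) unfolding window_borel_def by auto
      qed
    qed
    also have "?this \<longleftrightarrow> ?thesis"
      using assms(2,4) R unfolding window_continuous_def by (intro measurable_cong) simp
    finally show ?thesis .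
  qed
  have "correspondences X \<subseteq> Pow (X \<times> X)"
    by (auto simp: correspondences_def)
  then have countable: "countable (correspondences X)"
    using \<open>finite X\<close> by (meson countable_finite finite_Pow_iff finite_SigmaI finite_subset)
  from countable borel show ?thesis
    unfolding corr_dist_def[abs_def] by (rule borel_measurable_INF)
qed

theorem corollary52:
  fixes M :: "'a measure" and X :: "'x set"
    and f :: "('x \<times> 'x) set \<Rightarrow> 'a \<Rightarrow> 'a \<Rightarrow> ennreal"
    and g :: "'x set \<Rightarrow> 'x set \<Rightarrow> ('x \<times> 'x) set \<Rightarrow> 'a \<Rightarrow> 'a \<Rightarrow> ennreal"
  assumes "standard_borel M"
    and "countable X"
    and "(\<lambda>(R, d, p). f R d p)
      \<in> borel_measurable (borel_of (correspondence_topology X) \<Otimes>\<^sub>M (M \<Otimes>\<^sub>M M))"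
    and "ext_pseudometric_on (space M) (corr_dist X f)"
    and "window_monotone X (space M) g"
    and "window_continuous X (space M) f g"
    and "window_borel X M g"
    and "window_symmetric X (space M) g"
    and "window_transitive X (space M) g"
  shows "\<forall>d\<in>space M. {p \<in> space M. corr_dist X f d p = 0} \<in> sets M"
proof (cases "finite X")
  case True
  show ?thesis
  proof
    fix d assume "d \<in> space M"
    then have "corr_dist X f d \<in> borel_measurable M"
      by (rule borel_measurable_corr_dist_finite[OF True assms(6,7)])
    then show "{p \<in> space M. corr_dist X f d p = 0} \<in> sets M"
      by measurable
  qed
next
  case False
  then interpret approximated_correspondence_distance M X f g
    using assms(2,5-9) by unfold_locales
  show ?thesis
    using zero_distance_set_borel by blast
qed

end
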